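(* For all $s\in\mathcal S$ one has $\Phi_{\mathrm z}s\cdot\Psi_{\mathrm z}s=1$. Furthermore, any pair of functors $(F:\mathcal C\to\mathcal D,\ G:\mathcal S^{\mathrm{op}}\to\mathcal D)$ satisfying the Beck-Chevalley property and the equalities $Fs\cdot Gs=1$ $(s\in\mathcal S)$ factors through the pair $(\Phi_{\mathrm z},\Psi_{\mathrm z})$ by a functor $H:\mathsf{Retr}(\mathcal C,\mathcal S)\to\mathcal D$ that is uniquely determined by $H\Phi_{\mathrm z}=F$, $H\Psi_{\mathrm z}=G$.
   Context: Standing assumptions: $\mathcal C$ is a category and $\mathcal S$ is a class of morphisms of $\mathcal C$ that contains all isomorphisms, is closed under composition, and is such that pullbacks of $\mathcal S$-morphisms along arbitrary morphisms exist in $\mathcal C$ and belong to $\mathcal S$. $\mathcal S$ is also regarded as a subcategory of $\mathcal C$ with the same objects. An $\mathcal S$-span $(s,f):A\to B$ is a pair $s:D\to A$ in $\mathcal S$, $f:D\to B$ in $\mathcal C$. A (vertical) morphism $x:(s,f)\to(\tilde s,\tilde f)$ of $\mathcal S$-spans from $A$ to $B$ is a $\mathcal C$-morphism $x$ with $\tilde s\cdot x=s$, $\tilde f\cdot x=f$. Isomorphic $\mathcal S$-spans are identified. $\mathsf{Span}(\mathcal C,\mathcal S)$ is the category with the objects of $\mathcal C$ and (isomorphism classes of) $\mathcal S$-spans as morphisms, with (horizontal) composition $(t,g)\cdot(s,f)=(s\cdot t',g\cdot f')$, where $f\cdot t'=t\cdot f'$ is a pullback square. A relation for $\mathcal S$-spans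 is compatible if it relates only $\mathcal S$-spans with the same domain and codomain, relates vertically isomorphic $\mathcal S$-spans, and is preserved by horizontal composition from either side. For a compatible equivalence relation $\sim$, $\mathsf{Span}_\sim(\mathcal C,\mathcal S)$ is the quotient category whose morphisms are the classes $[s,f]_\sim$. For $\mathcal S$-spans with the same domain and codomain put $(s,f)\leqslant(\tilde s,\tilde f)$ iff there is a morphism $x:(s,f)\to(\tilde s,\tilde f)$ with $x\in\mathcal S$. The zig-zag relation $\sim_{\mathrm z}$ is the least equivalence relation containing $\leqslant$; it is compatible. $\mathsf{Retr}(\mathcal C,\mathcal S):=\mathsf{Span}_{\sim_{\mathrm z}}(\mathcal C,\mathcal S)$, with the identity-on-objects functors $\Phi_{\mathrm z}:\mathcal C\to\mathsf{Retr}(\mathcal C,\mathcal S)$, $f\mapsto[1,f]_{\mathrm z}$, and $\Psi_{\mathrm z}:\mathcal S^{\mathrm{op}}\to\mathsf{Retr}(\mathcal C,\mathcal S)$, $s\mapsto[s,1]_{\mathrm z}$. A pair of functors $F:\mathcal C\to\mathcal D$, $G:\mathcal S^{\mathrm{op}}\to\mathcal D$ satisfies the Beck-Chevalley property if $F$ and $G$ coincide on objects and, for every pullback square $s\cdot f'=f\cdot s'$ in $\mathcal C$ with $s\in\mathcal S$ ($s'$ being the pullback of $s$ along $f$), one has $Gs\cdot Ff=Ff'\cdot Gs'$. *)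

theory Defs
  imports Main
begin

record ('o, 'm) cat =
  objs :: "'o set"
  arrs :: "'m set"
  src  :: "'m \<Rightarrow> 'o"
  tgt  :: "'m \<Rightarrow> 'o"
  idt  :: "'o \<Rightarrow> 'm"
  cmp  :: "'m \<Rightarrow> 'm \<Rightarrow> 'm"  (infixl "\<cdot>\<index>" 70)

locale category =
  fixes C :: "('o, 'm) cat" (structure)
  assumes src_obj: "f \<in> arrs C \<Longrightarrow> src C f \<in> objs C"
    and tgt_obj: "f \<in> arrs C \<Longrightarrow> tgt C f \<in> objs C"
    and idt_arr: "a \<in> objs C \<Longrightarrow> idt C a \<in> arrs C"
    and src_idt: "a \<in> objs C \<Longrightarrow> src C (idt C a) = a"
    and tgt_idt: "a \<in> objs C \<Longrightarrow> tgt C (idt C a) = a"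
    and cmp_arr: "\<lbrakk>f \<in> arrs C; g \<in> arrs C; tgt C f = src C g\<rbrakk> \<Longrightarrow> g \<cdot> f \<in> arrs C"
    and src_cmp: "\<lbrakk>f \<in> arrs C; g \<in> arrs C; tgt C f = src C g\<rbrakk> \<Longrightarrow> src C (g \<cdot> f) = src C f"
    and tgt_cmp: "\<lbrakk>f \<in> arrs C; g \<in> arrs C; tgt C f = src C g\<rbrakk> \<Longrightarrow> tgt C (g \<cdot> f) = tgt C g"
    and idt_right: "f \<in> arrs C \<Longrightarrow> f \<cdot> idt C (src C f) = f"
    and idt_left: "f \<in> arrs C \<Longrightarrow> idt C (tgt C f) \<cdot> f = f"
    and cmp_assoc: "\<lbrakk>f \<in> arrs C; g \<in> arrs C; h \<in> arrs C; tgt C f = src C g; tgt C g = src C h\<rbrakk>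
      \<Longrightarrow> (h \<cdot> g) \<cdot> f = h \<cdot> (g \<cdot> f)"

definition op_cat :: "('o, 'm) cat \<Rightarrow> ('o, 'm) cat" where
  "op_cat C = C\<lparr>src := tgt C, tgt := src C, cmp := (\<lambda>g f. f \<cdot>\<^bsub>C\<^esub> g)\<rparr>"

definition wide_subcat :: "('o, 'm) cat \<Rightarrow> 'm set \<Rightarrow> ('o, 'm) cat" where
  "wide_subcat C S = C\<lparr>arrs := S\<rparr>"

record ('o, 'm, 'p, 'n) fctr =
  omap :: "'o \<Rightarrow> 'p"
  amap :: "'m \<Rightarrow> 'n"

locale cat_functor = A: category A + B: category B
  for A :: "('o, 'm) cat" and B :: "('p, 'n) cat" +
  fixes F :: "('o, 'm, 'p, 'n) fctr"
  assumes omap_obj: "a \<in> objs A \<Longrightarrow> omap F a \<in> objs B"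
    and amap_arr: "f \<in> arrs A \<Longrightarrow> amap F f \<in> arrs B"
    and amap_src: "f \<in> arrs A \<Longrightarrow> src B (amap F f) = omap F (src A f)"
    and amap_tgt: "f \<in> arrs A \<Longrightarrow> tgt B (amap F f) = omap F (tgt A f)"
    and amap_idt: "a \<in> objs A \<Longrightarrow> amap F (idt A a) = idt B (omap F a)"
    and amap_cmp: "\<lbrakk>f \<in> arrs A; g \<in> arrs A; tgt A f = src A g\<rbrakk>
      \<Longrightarrow> amap F (g \<cdot>\<^bsub>A\<^esub> f) = amap F g \<cdot>\<^bsub>B\<^esub> amap F f"

definition fctr_comp ::
    "('p, 'n, 'q, 'k) fctr \<Rightarrow> ('o, 'm, 'p, 'n) fctr \<Rightarrow> ('o, 'm, 'q, 'k) fctr" where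
  "fctr_comp H F = \<lparr>omap = omap H \<circ> omap F, amap = amap H \<circ> amap F\<rparr>"

text \<open>Equality of functors out of \<open>A\<close>: values outside the carriers of \<open>A\<close> carry no meaning.\<close>

definition fctr_eq ::
    "('o, 'm) cat \<Rightarrow> ('o, 'm, 'p, 'n) fctr \<Rightarrow> ('o, 'm, 'p, 'n) fctr \<Rightarrow> bool" where
  "fctr_eq A F G \<longleftrightarrow>
     (\<forall>a\<in>objs A. omap F a = omap G a) \<and> (\<forall>f\<in>arrs A. amap F f = amap G f)"

definition is_iso :: "('o, 'm) cat \<Rightarrow> 'm \<Rightarrow> bool" where
  "is_iso C f \<longleftrightarrow> f \<in> arrs C \<and>
     (\<exists>g\<in>arrs C. src C g = tgt C f \<and> tgt C g = src C f \<and>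
        g \<cdot>\<^bsub>C\<^esub> f = idt C (src C f) \<and> f \<cdot>\<^bsub>C\<^esub> g = idt C (tgt C f))"

text \<open>\<open>is_pullback C s f s' f'\<close>: the square \<open>s \<cdot> f' = f \<cdot> s'\<close> is a pullback, so that \<open>s'\<close> is
  the pullback of \<open>s\<close> along \<open>f\<close>.\<close>

definition is_pullback :: "('o, 'm) cat \<Rightarrow> 'm \<Rightarrow> 'm \<Rightarrow> 'm \<Rightarrow> 'm \<Rightarrow> bool" where
  "is_pullback C s f s' f' \<longleftrightarrow>
     s \<in> arrs C \<and> f \<in> arrs C \<and> s' \<in> arrs C \<and> f' \<in> arrs C \<and>
     tgt C s = tgt C f \<and> src C s' = src C f' \<and> tgt C s' = src C f \<and> tgt C f' = src C s \<and>
     s \<cdot>\<^bsub>C\<^esub> f' = f \<cdot>\<^bsub>C\<^esub> s' \<and>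
     (\<forall>a\<in>arrs C. \<forall>b\<in>arrs C.
        src C a = src C b \<and> tgt C a = src C s \<and> tgt C b = src C f \<and>
        s \<cdot>\<^bsub>C\<^esub> a = f \<cdot>\<^bsub>C\<^esub> b \<longrightarrow>
        (\<exists>!h. h \<in> arrs C \<and> src C h = src C a \<and> tgt C h = src C s' \<and>
           f' \<cdot>\<^bsub>C\<^esub> h = a \<and> s' \<cdot>\<^bsub>C\<^esub> h = b))"

locale stable_class = category C for C :: "('o, 'm) cat" (structure) +
  fixes S :: "'m set"
  assumes S_arrs: "S \<subseteq> arrs C"
    and iso_S: "is_iso C f \<Longrightarrow> f \<in> S"
    and cmp_S: "\<lbrakk>s \<in> S; t \<in> S; tgt C s = src C t\<rbrakk> \<Longrightarrow> t \<cdot> s \<in> S"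
    and pullback_ex: "\<lbrakk>s \<in> S; f \<in> arrs C; tgt C s = tgt C f\<rbrakk>
      \<Longrightarrow> \<exists>s' f'. is_pullback C s f s' f'"
    and pullback_S: "\<lbrakk>s \<in> S; is_pullback C s f s' f'\<rbrakk> \<Longrightarrow> s' \<in> S"

text \<open>A span \<open>(s, f)\<close> goes from \<open>tgt C s\<close> to \<open>tgt C f\<close>.\<close>

definition spans :: "('o, 'm) cat \<Rightarrow> 'm set \<Rightarrow> ('m \<times> 'm) set" where
  "spans C S = {(s, f). s \<in> S \<and> f \<in> arrs C \<and> src C s = src C f}"

definition span_mor :: "('o, 'm) cat \<Rightarrow> 'm \<Rightarrow> 'm \<times> 'm \<Rightarrow> 'm \<times> 'm \<Rightarrow> bool" where
  "span_mor C x p q \<longleftrightarrow>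
     x \<in> arrs C \<and> src C x = src C (fst p) \<and> tgt C x = src C (fst q) \<and>
     fst q \<cdot>\<^bsub>C\<^esub> x = fst p \<and> snd q \<cdot>\<^bsub>C\<^esub> x = snd p"

definition span_le :: "('o, 'm) cat \<Rightarrow> 'm set \<Rightarrow> (('m \<times> 'm) \<times> ('m \<times> 'm)) set" where
  "span_le C S = {(p, q). p \<in> spans C S \<and> q \<in> spans C S \<and>
     tgt C (fst p) = tgt C (fst q) \<and> tgt C (snd p) = tgt C (snd q) \<and>
     (\<exists>x\<in>S. span_mor C x p q)}"

inductive_set zigzag :: "('o, 'm) cat \<Rightarrow> 'm set \<Rightarrow> (('m \<times> 'm) \<times> ('m \<times> 'm)) set"
  for C S where
  base: "(p, q) \<in> span_le C S \<Longrightarrow> (p, q) \<in> zigzag C S"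
| refl: "p \<in> spans C S \<Longrightarrow> (p, p) \<in> zigzag C S"
| sym: "(p, q) \<in> zigzag C S \<Longrightarrow> (q, p) \<in> zigzag C S"
| trans: "\<lbrakk>(p, q) \<in> zigzag C S; (q, r) \<in> zigzag C S\<rbrakk> \<Longrightarrow> (p, r) \<in> zigzag C S"

text \<open>\<open>is_span_comp C q p w\<close>: \<open>w\<close> is a horizontal composite \<open>q \<cdot> p\<close>, for some choice of the
  pullback. Composites are thus determined up to vertical isomorphism only.\<close>

definition is_span_comp :: "('o, 'm) cat \<Rightarrow> 'm \<times> 'm \<Rightarrow> 'm \<times> 'm \<Rightarrow> 'm \<times> 'm \<Rightarrow> bool" where
  "is_span_comp C q p w \<longleftrightarrow>
     (\<exists>t' f'. is_pullback C (fst q) (snd p) t' f' \<and>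
        w = (fst p \<cdot>\<^bsub>C\<^esub> t', snd q \<cdot>\<^bsub>C\<^esub> f'))"

text \<open>The category of spans modulo a compatible equivalence relation \<open>R\<close> on \<open>spans C S\<close>; its
  morphisms are the \<open>R\<close>-classes. As \<open>R\<close> relates vertically isomorphic spans, there is no need
  to pass to isomorphism classes first. For such \<open>R\<close>, all spans in a class have the same ends,
  and the composites of representatives of two composable classes lie in exactly one class,
  so \<open>src\<close>, \<open>tgt\<close> and \<open>cmp\<close> below involve no choices.\<close>

definition Span_quot ::
    "('o, 'm) cat \<Rightarrow> 'm set \<Rightarrow> (('m \<times> 'm) \<times> ('m \<times> 'm)) set \<Rightarrow> ('o, ('m \<times> 'm) set) cat" where
  "Span_quot C S R =
     \<lparr>objs = objs C,
      arrs = spans C S // R,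
      src = (\<lambda>X. the_elem ((\<lambda>p. tgt C (fst p)) ` X)),
      tgt = (\<lambda>X. the_elem ((\<lambda>p. tgt C (snd p)) ` X)),
      idt = (\<lambda>a. R `` {(idt C a, idt C a)}),
      cmp = (\<lambda>Y X. R `` {w. \<exists>q\<in>Y. \<exists>p\<in>X. is_span_comp C q p w})\<rparr>"

definition Retr :: "('o, 'm) cat \<Rightarrow> 'm set \<Rightarrow> ('o, ('m \<times> 'm) set) cat" where
  "Retr C S = Span_quot C S (zigzag C S)"

definition Phi_z :: "('o, 'm) cat \<Rightarrow> 'm set \<Rightarrow> ('o, 'm, 'o, ('m \<times> 'm) set) fctr" where
  "Phi_z C S = \<lparr>omap = (\<lambda>a. a), amap = (\<lambda>f. zigzag C S `` {(idt C (src C f), f)})\<rparr>"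

definition Psi_z :: "('o, 'm) cat \<Rightarrow> 'm set \<Rightarrow> ('o, 'm, 'o, ('m \<times> 'm) set) fctr" where
  "Psi_z C S = \<lparr>omap = (\<lambda>a. a), amap = (\<lambda>s. zigzag C S `` {(s, idt C (src C s))})\<rparr>"

definition beck_chevalley ::
    "('o, 'm) cat \<Rightarrow> 'm set \<Rightarrow> ('p, 'n) cat \<Rightarrow>
     ('o, 'm, 'p, 'n) fctr \<Rightarrow> ('o, 'm, 'p, 'n) fctr \<Rightarrow> bool" where
  "beck_chevalley C S D F G \<longleftrightarrow>
     (\<forall>a\<in>objs C. omap F a = omap G a) \<and>
     (\<forall>s f s' f'. s \<in> S \<and> is_pullback C s f s' f' \<longrightarrow>
        amap G s \<cdot>\<^bsub>D\<^esub> amap F f = amap F f' \<cdot>\<^bsub>D\<^esub> amap G s')"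

end

theory Submission
  imports Defs
begin

text \<open>Composites of spans respect \<open>\<le>\<close> in either argument: the comparison morphism between the
  apexes is, by pullback cancellation, itself a pullback of the given \<open>S\<close>-morphism. Hence the
  classes compose. Every span is \<open>(s, f) = (1, f) \<cdot> (s, 1)\<close>, which forces \<open>H[s, f] = F f \<cdot> G s\<close>;
  this is constant on zig-zag classes since \<open>F x \<cdot> G x = 1\<close> and functorial by Beck-Chevalley.\<close>

section \<open>Pullback squares: joint monicity, pasting and cancellation\<close>

context category
begin

lemmas typing [simp] = src_obj tgt_obj idt_arr src_idt tgt_idt cmp_arr src_cmp tgt_cmp

lemma idt_idt [simp]: "a \<in> objs C \<Longrightarrow> idt C a \<cdot> idt C a = idt C a"
  using idt_left[of "idt C a"] by simp

lemma pullback_typing: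
  assumes "is_pullback C s f s' f'"
  shows "s \<in> arrs C" "f \<in> arrs C" "s' \<in> arrs C" "f' \<in> arrs C"
    "tgt C s = tgt C f" "src C s' = src C f'" "tgt C s' = src C f" "tgt C f' = src C s"
    "s \<cdot> f' = f \<cdot> s'"
  using assms unfolding is_pullback_def by blast+

lemma pullback_lift:
  assumes "is_pullback C s f s' f'" "a \<in> arrs C" "b \<in> arrs C" "src C a = src C b"
    "tgt C a = src C s" "tgt C b = src C f" "s \<cdot> a = f \<cdot> b"
  obtains h where "h \<in> arrs C" "src C h = src C a" "tgt C h = src C s'" "f' \<cdot> h = a" "s' \<cdot> h = b"
  using assms unfolding is_pullback_def by blast

text \<open>The legs of a pullback are jointly monic: \<open>h\<close> and \<open>k\<close> both
  mediate for the cone \<open>f' \<cdot> h\<close>, \<open>s' \<cdot> h\<close>, and the definition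
  admits only one such morphism.\<close>

lemma pullback_unique:
  assumes pb: "is_pullback C s f s' f'" and h: "h \<in> arrs C" "tgt C h = src C s'"
    and k: "k \<in> arrs C" "tgt C k = src C s'" "src C k = src C h"
    and eq: "f' \<cdot> h = f' \<cdot> k" "s' \<cdot> h = s' \<cdot> k"
  shows "h = k"
proof -
  note t = pullback_typing[OF pb]
  have "s \<cdot> (f' \<cdot> h) = f \<cdot> (s' \<cdot> h)"
    using t h by (simp add: cmp_assoc[symmetric])
  then have "f' \<cdot> h \<in> arrs C \<and> s' \<cdot> h \<in> arrs C \<and> src C (f' \<cdot> h) = src C (s' \<cdot> h) \<and>
      tgt C (f' \<cdot> h) = src C s \<and> tgt C (s' \<cdot> h) = src C f \<and> s \<cdot> (f' \<cdot> h) = f \<cdot> (s' \<cdot> h)"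
    using t h by simp
  then have "\<exists>!j. j \<in> arrs C \<and> src C j = src C (f' \<cdot> h) \<and> tgt C j = src C s' \<and>
      f' \<cdot> j = f' \<cdot> h \<and> s' \<cdot> j = s' \<cdot> h"
    using pb unfolding is_pullback_def by blast
  then show ?thesis
    using t h k eq by (metis src_cmp)
qed

text \<open>Splits the unique existence of the definition into a lifting condition and joint
  monicity. The latter mentions no cone, which simplifies the verifications below.\<close>

lemma is_pullbackI:
  assumes "s \<in> arrs C" "f \<in> arrs C" "s' \<in> arrs C" "f' \<in> arrs C"
    "tgt C s = tgt C f" "src C s' = src C f'" "tgt C s' = src C f" "tgt C f' = src C s"
    "s \<cdot> f' = f \<cdot> s'"
    and "\<And>a b. \<lbrakk>a \<in> arrs C; b \<in> arrs C; src C a = src C b; tgt C a = src C s; tgt C b = src C f;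
        s \<cdot> a = f \<cdot> b\<rbrakk> \<Longrightarrow> \<exists>h\<in>arrs C. src C h = src C a \<and> tgt C h = src C s' \<and> f' \<cdot> h = a \<and> s' \<cdot> h = b"
    and "\<And>h k. \<lbrakk>h \<in> arrs C; k \<in> arrs C; tgt C h = src C s'; tgt C k = src C s'; src C k = src C h;
        f' \<cdot> h = f' \<cdot> k; s' \<cdot> h = s' \<cdot> k\<rbrakk> \<Longrightarrow> h = k"
  shows "is_pullback C s f s' f'"
  unfolding is_pullback_def
proof (intro conjI ballI impI)
  fix a b assume "a \<in> arrs C" "b \<in> arrs C"
    "src C a = src C b \<and> tgt C a = src C s \<and> tgt C b = src C f \<and> s \<cdot> a = f \<cdot> b"
  then obtain h where "h \<in> arrs C" "src C h = src C a \<and> tgt C h = src C s' \<and> f' \<cdot> h = a \<and> s' \<cdot> h = b"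
    using assms(10) by blast
  then show "\<exists>!h. h \<in> arrs C \<and> src C h = src C a \<and> tgt C h = src C s' \<and> f' \<cdot> h = a \<and> s' \<cdot> h = b"
    by (intro ex1I[of _ h]) (auto intro!: assms(11))
qed (use assms in auto)

lemma pullback_sym:
  assumes pb: "is_pullback C s f s' f'"
  shows "is_pullback C f s f' s'"
proof (rule is_pullbackI)
  fix a b assume "a \<in> arrs C" "b \<in> arrs C" "src C a = src C b"
    "tgt C a = src C f" "tgt C b = src C s" "f \<cdot> a = s \<cdot> b"
  then show "\<exists>h\<in>arrs C. src C h = src C a \<and> tgt C h = src C f' \<and> s' \<cdot> h = a \<and> f' \<cdot> h = b"
    using pullback_lift[OF pb, of b a] pullback_typing[OF pb] by metis
qed (use pullback_typing[OF pb] pullback_unique[OF pb] in auto)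

lemma pullback_idt:
  assumes "f \<in> arrs C"
  shows "is_pullback C (idt C (tgt C f)) f (idt C (src C f)) f"
proof (rule is_pullbackI)
  fix a b assume "a \<in> arrs C" "b \<in> arrs C" "src C a = src C b"
    "tgt C a = src C (idt C (tgt C f))" "tgt C b = src C f" "idt C (tgt C f) \<cdot> a = f \<cdot> b"
  \<comment> \<open>The leg \<open>b\<close> is its own lift, since the commuting cone says
    \<open>a = f \<cdot> b\<close>.\<close>
  then show "\<exists>h\<in>arrs C. src C h = src C a \<and> tgt C h = src C (idt C (src C f)) \<and>
      f \<cdot> h = a \<and> idt C (src C f) \<cdot> h = b"
    using assms by (intro bexI[of _ b]) (auto, metis idt_left, metis idt_left)
next
  fix h k assume "h \<in> arrs C" "k \<in> arrs C"
    "tgt C h = src C (idt C (src C f))" "tgt C k = src C (idt C (src C f))"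
    "idt C (src C f) \<cdot> h = idt C (src C f) \<cdot> k"
  then show "h = k" using assms by (metis idt_left src_idt src_obj)
qed (use assms in \<open>auto simp: idt_left idt_right\<close>)

text \<open>A cone over the outer square is lifted first through the right square \<open>r\<close>,
  then through the left square \<open>l\<close>. Associativity of span composition rests on
  this.\<close>

lemma pullback_pasting:
  assumes r: "is_pullback C s f s' f'" and l: "is_pullback C s' x s'' y"
  shows "is_pullback C s (f \<cdot> x) s'' (f' \<cdot> y)"
proof -
  note t [simp] = pullback_typing(1-8)[OF r] pullback_typing(2-8)[OF l]
  have e: "s \<cdot> f' = f \<cdot> s'" "s' \<cdot> y = x \<cdot> s''"
    using pullback_typing(9)[OF r] pullback_typing(9)[OF l] .
  have x: "tgt C x = src C f" using pullback_typing[OF r] pullback_typing[OF l] by metis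
  have sq: "s \<cdot> (f' \<cdot> y) = f \<cdot> x \<cdot> s''"
    using x e by (metis cmp_assoc t)
  show ?thesis
  proof (rule is_pullbackI)
    fix a b assume ab: "a \<in> arrs C" "b \<in> arrs C" "src C a = src C b"
      "tgt C a = src C s" "tgt C b = src C (f \<cdot> x)" "s \<cdot> a = f \<cdot> x \<cdot> b"
    have b: "tgt C b = src C x" using ab x by simp
    obtain h where h: "h \<in> arrs C" "src C h = src C a" "tgt C h = src C s'" "f' \<cdot> h = a" "s' \<cdot> h = x \<cdot> b"
      using pullback_lift[OF r, of a "x \<cdot> b"] ab x b by (auto simp: cmp_assoc)
    obtain k where k: "k \<in> arrs C" "src C k = src C h" "tgt C k = src C s''" "y \<cdot> k = h" "s'' \<cdot> k = b"
      using pullback_lift[OF l, of h b] ab b h by auto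
    show "\<exists>h\<in>arrs C. src C h = src C a \<and> tgt C h = src C s'' \<and> f' \<cdot> y \<cdot> h = a \<and> s'' \<cdot> h = b"
      using h k by (intro bexI[of _ k]) (auto simp: cmp_assoc)
  next
    fix h k assume hk: "h \<in> arrs C" "k \<in> arrs C" "tgt C h = src C s''" "tgt C k = src C s''"
      "src C k = src C h" "f' \<cdot> y \<cdot> h = f' \<cdot> y \<cdot> k" "s'' \<cdot> h = s'' \<cdot> k"
    \<comment> \<open>Joint monicity of \<open>r\<close> needs agreement after \<open>s'\<close>
      too; it comes from \<open>s' \<cdot> y = x \<cdot> s''\<close>.\<close>
    have s: "s' \<cdot> (y \<cdot> h) = s' \<cdot> (y \<cdot> k)"
      using hk e x by (simp add: cmp_assoc[symmetric]) (simp add: cmp_assoc)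
    have "y \<cdot> h = y \<cdot> k"
      by (rule pullback_unique[OF r]) (use hk s in \<open>auto simp: cmp_assoc\<close>)
    then show "h = k"
      using pullback_unique[OF l, of h k] hk by simp
  qed (use x sq in auto)
qed

text \<open>Lifts come from the outer square, and joint monicity of the right square identifies
  their image under \<open>y\<close>. Comparison morphisms between composite spans are later
  recognised as pullbacks in this way.\<close>

lemma pullback_cancel:
  assumes r: "is_pullback C s f s' f'" and o: "is_pullback C s (f \<cdot> x) s'' (f' \<cdot> y)"
    and x: "x \<in> arrs C" "tgt C x = src C f"
    and y: "y \<in> arrs C" "tgt C y = src C s'" "s' \<cdot> y = x \<cdot> s''"
  shows "is_pullback C s' x s'' y"
proof -
  note t = pullback_typing(1-8)[OF r] pullback_typing(2-8)[OF o]
  have [simp]: "tgt C s'' = src C x" "src C s'' = src C y"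
    using t x y by simp_all
  note [simp] = pullback_typing(1-8)[OF r] pullback_typing(3)[OF o] x(1) y(1)
  have e: "s \<cdot> f' = f \<cdot> s'" using pullback_typing(9)[OF r] .
  show ?thesis
  proof (rule is_pullbackI)
    fix a b assume ab: "a \<in> arrs C" "b \<in> arrs C" "src C a = src C b"
      "tgt C a = src C s'" "tgt C b = src C x" "s' \<cdot> a = x \<cdot> b"
    have "s \<cdot> (f' \<cdot> a) = f \<cdot> x \<cdot> b"
      using ab x e by (simp add: cmp_assoc[symmetric]) (simp add: cmp_assoc)
    then obtain h where h: "h \<in> arrs C" "src C h = src C a" "tgt C h = src C s''"
        "f' \<cdot> y \<cdot> h = f' \<cdot> a" "s'' \<cdot> h = b"
      using pullback_lift[OF o, of "f' \<cdot> a" b] ab x by auto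
    have s: "s' \<cdot> (y \<cdot> h) = s' \<cdot> a"
      using h ab x y by (simp add: cmp_assoc[symmetric]) (simp add: cmp_assoc)
    \<comment> \<open>The outer lift only yields this equation after composing with
      \<open>f'\<close>; the fact \<open>s\<close> adds the one after \<open>s'\<close>.\<close>
    have "y \<cdot> h = a"
      by (rule pullback_unique[OF r]) (use h ab y s in \<open>auto simp: cmp_assoc\<close>)
    then show "\<exists>h\<in>arrs C. src C h = src C a \<and> tgt C h = src C s'' \<and> y \<cdot> h = a \<and> s'' \<cdot> h = b"
      using h by blast
  next
    fix h k assume hk: "h \<in> arrs C" "k \<in> arrs C" "tgt C h = src C s''" "tgt C k = src C s''"
      "src C k = src C h" "y \<cdot> h = y \<cdot> k" "s'' \<cdot> h = s'' \<cdot> k"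
    then show "h = k"
      using pullback_unique[OF o, of h k] y by (simp add: cmp_assoc)
  qed (use x y in auto)
qed

end

section \<open>Spans and the zig-zag equivalence\<close>

context stable_class
begin

abbreviation cls :: "'m \<times> 'm \<Rightarrow> ('m \<times> 'm) set"
  where "cls p \<equiv> zigzag C S `` {p}"

lemma S_arr [simp]: "s \<in> S \<Longrightarrow> s \<in> arrs C"
  using S_arrs by blast

lemma idt_S [simp]: "a \<in> objs C \<Longrightarrow> idt C a \<in> S"
  by (rule iso_S) (auto simp: is_iso_def intro!: bexI[of _ "idt C a"])

lemma spans_iff [simp]: "(s, f) \<in> spans C S \<longleftrightarrow> s \<in> S \<and> f \<in> arrs C \<and> src C s = src C f"
  by (simp add: spans_def)

text \<open>The identity of the apex is an isomorphism, hence in \<open>S\<close>. Reflexivity lets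
  the monotonicity lemmas also compare two composites of the same spans formed with different
  pullbacks.\<close>

lemma span_le_refl:
  assumes "p \<in> spans C S"
  shows "(p, p) \<in> span_le C S"
proof -
  obtain s f where p: "p = (s, f)" and sf: "s \<in> S" "f \<in> arrs C" "src C s = src C f"
    using assms by (cases p) auto
  have "span_mor C (idt C (src C f)) p p"
    using sf idt_right[of s] idt_right[of f] by (simp add: span_mor_def p)
  then show ?thesis
    using sf unfolding span_le_def p by (auto intro: idt_S src_obj)
qed

lemma zigzag_spans:
  assumes "(p, q) \<in> zigzag C S"
  shows "p \<in> spans C S" "q \<in> spans C S" "tgt C (fst p) = tgt C (fst q)" "tgt C (snd p) = tgt C (snd q)"
  using assms by (induction) (auto simp: span_le_def)

lemma equiv_zigzag: "equiv (spans C S) (zigzag C S)"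
  by (rule equivI)
    (auto simp: refl_on_def sym_def trans_def dest: zigzag_spans intro: zigzag.intros)

lemma cls_eq_iff: "\<lbrakk>p \<in> spans C S; q \<in> spans C S\<rbrakk> \<Longrightarrow> cls p = cls q \<longleftrightarrow> (p, q) \<in> zigzag C S"
  using eq_equiv_class_iff[OF equiv_zigzag] by blast

section \<open>Horizontal composition and its compatibility with zig-zags\<close>

lemma span_comp_ex:
  assumes "p \<in> spans C S" "q \<in> spans C S" "tgt C (snd p) = tgt C (fst q)"
  obtains w where "is_span_comp C q p w"
  using assms pullback_ex[of "fst q" "snd p"] unfolding is_span_comp_def by (cases p; cases q) fastforce

lemma span_comp_composable: "is_span_comp C q p w \<Longrightarrow> tgt C (snd p) = tgt C (fst q)"
  using pullback_typing(5) unfolding is_span_comp_def by fastforce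

lemma span_comp_typing:
  assumes "is_span_comp C q p w" "p \<in> spans C S" "q \<in> spans C S"
  shows "w \<in> spans C S" "tgt C (fst w) = tgt C (fst p)" "tgt C (snd w) = tgt C (snd q)"
proof -
  obtain s f t g where pq: "p = (s, f)" "q = (t, g)" by (cases p; cases q)
  obtain t' f' where pb: "is_pullback C t f t' f'" and w: "w = (s \<cdot> t', g \<cdot> f')"
    using assms(1) unfolding is_span_comp_def pq by auto
  have "t' \<in> S" using pullback_S[OF _ pb] assms pq by simp
  then show "w \<in> spans C S" "tgt C (fst w) = tgt C (fst p)" "tgt C (snd w) = tgt C (snd q)"
    using pullback_typing[OF pb] assms(2,3) unfolding pq w by (auto simp: cmp_S)
qed

text \<open>The universal property of the square for \<open>h\<close> yields \<open>y\<close>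
  between the apexes. As \<open>f = h \<cdot> x\<close>, the square for \<open>f\<close> is an outer
  square over the one for \<open>h\<close>, so cancellation makes \<open>y\<close> a pullback of
  \<open>x\<close>.\<close>

lemma span_comp_mono_right:
  assumes le: "(p, q) \<in> span_le C S" and r: "r \<in> spans C S"
    and w: "is_span_comp C r p w" and w': "is_span_comp C r q w'"
  shows "(w, w') \<in> span_le C S"
proof -
  obtain s f u h t g where eqs: "p = (s, f)" "q = (u, h)" "r = (t, g)" by (cases p; cases q; cases r)
  have sp: "p \<in> spans C S" "q \<in> spans C S" using le by (auto simp: span_le_def)
  obtain x where x: "x \<in> S" "src C x = src C s" "tgt C x = src C u" "u \<cdot> x = s" "h \<cdot> x = f"
    using le
    unfolding span_le_def span_mor_def eqs mem_Collect_eq case_prod_conv fst_conv snd_conv by blast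
  obtain t1 f1 where pb1: "is_pullback C t f t1 f1" and w1: "w = (s \<cdot> t1, g \<cdot> f1)"
    using w unfolding is_span_comp_def eqs by auto
  obtain t2 f2 where pb2: "is_pullback C t h t2 f2" and w2: "w' = (u \<cdot> t2, g \<cdot> f2)"
    using w' unfolding is_span_comp_def eqs by auto
  note t1 = pullback_typing[OF pb1] and t2 = pullback_typing[OF pb2]
  have [simp]: "src C u = src C h" "src C g = src C t" "src C s = src C f" "s \<in> S" "u \<in> S" "g \<in> arrs C"
    using sp r eqs by auto
  have "f1 \<in> arrs C" "x \<cdot> t1 \<in> arrs C" "src C f1 = src C (x \<cdot> t1)" "tgt C f1 = src C t"
    "tgt C (x \<cdot> t1) = src C h" "t \<cdot> f1 = h \<cdot> (x \<cdot> t1)"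
    using t1 t2 x by (simp_all add: cmp_assoc[symmetric])
  then obtain y where y: "y \<in> arrs C" "src C y = src C f1" "tgt C y = src C t2"
      "f2 \<cdot> y = f1" "t2 \<cdot> y = x \<cdot> t1"
    by (rule pullback_lift[OF pb2])
  have "is_pullback C t2 x t1 y"
    by (rule pullback_cancel[OF pb2]) (use x y pb1 in simp_all)
  \<comment> \<open>Flipping the square presents \<open>y\<close> as the pullback of
    \<open>x\<close> along \<open>t2\<close>, so stability of \<open>S\<close> applies.\<close>
  then have "y \<in> S" by (rule pullback_S[OF x(1) pullback_sym])
  moreover have "u \<cdot> t2 \<cdot> y = s \<cdot> t1"
  proof -
    have "u \<cdot> t2 \<cdot> y = u \<cdot> (x \<cdot> t1)" using y t2 by (simp add: cmp_assoc)
    also have "\<dots> = s \<cdot> t1" using x t1 by (simp add: cmp_assoc[symmetric])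
    finally show ?thesis .
  qed
  moreover have "g \<cdot> f2 \<cdot> y = g \<cdot> f1" using y t2 by (simp add: cmp_assoc)
  ultimately have "y \<in> S \<and> span_mor C y w w'"
    using y t1 t2 x unfolding span_mor_def w1 w2 by simp
  moreover have "tgt C (fst p) = tgt C (fst q)" "tgt C (snd p) = tgt C (snd q)"
    using le by (auto simp: span_le_def)
  ultimately show ?thesis
    using span_comp_typing[OF w sp(1) r] span_comp_typing[OF w' sp(2) r]
    unfolding span_le_def by auto
qed

text \<open>Now \<open>x\<close> enters through the leg being pulled back,
  \<open>s = u \<cdot> x\<close>. The squares are therefore flipped before cancelling, and
  \<open>y\<close> is the pullback of \<open>x\<close> along \<open>g2\<close>.\<close>

lemma span_comp_mono_left:
  assumes le: "(p, q) \<in> span_le C S" and r: "r \<in> spans C S"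
    and w: "is_span_comp C p r w" and w': "is_span_comp C q r w'"
  shows "(w, w') \<in> span_le C S"
proof -
  obtain s f u h t g where eqs: "p = (s, f)" "q = (u, h)" "r = (t, g)" by (cases p; cases q; cases r)
  have sp: "p \<in> spans C S" "q \<in> spans C S" using le by (auto simp: span_le_def)
  obtain x where x: "x \<in> S" "src C x = src C s" "tgt C x = src C u" "u \<cdot> x = s" "h \<cdot> x = f"
    using le
    unfolding span_le_def span_mor_def eqs mem_Collect_eq case_prod_conv fst_conv snd_conv by blast
  obtain s1 g1 where pb1: "is_pullback C s g s1 g1" and w1: "w = (t \<cdot> s1, f \<cdot> g1)"
    using w unfolding is_span_comp_def eqs by auto
  obtain u2 g2 where pb2: "is_pullback C u g u2 g2" and w2: "w' = (t \<cdot> u2, h \<cdot> g2)"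
    using w' unfolding is_span_comp_def eqs by auto
  note t1 = pullback_typing[OF pb1] and t2 = pullback_typing[OF pb2]
  have [simp]: "src C u = src C h" "src C t = src C g" "src C s = src C f" "u \<in> S" "h \<in> arrs C" "t \<in> S"
    using sp r eqs by auto
  have "x \<cdot> g1 \<in> arrs C" "s1 \<in> arrs C" "src C (x \<cdot> g1) = src C s1" "tgt C (x \<cdot> g1) = src C u"
    "tgt C s1 = src C g" "u \<cdot> (x \<cdot> g1) = g \<cdot> s1"
    using t1 t2 x by (simp_all add: cmp_assoc[symmetric])
  then obtain y where y: "y \<in> arrs C" "src C y = src C (x \<cdot> g1)" "tgt C y = src C u2"
      "g2 \<cdot> y = x \<cdot> g1" "u2 \<cdot> y = s1"
    by (rule pullback_lift[OF pb2])
  have "is_pullback C g2 x g1 y"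
    by (rule pullback_cancel[OF pullback_sym[OF pb2]])
      (use x y t2 pullback_sym[OF pb1] in simp_all)
  then have "y \<in> S" by (rule pullback_S[OF x(1) pullback_sym])
  moreover have "h \<cdot> g2 \<cdot> y = f \<cdot> g1"
  proof -
    have "h \<cdot> g2 \<cdot> y = h \<cdot> (x \<cdot> g1)" using y t2 by (simp add: cmp_assoc)
    also have "\<dots> = f \<cdot> g1" using x t1 by (simp add: cmp_assoc[symmetric])
    finally show ?thesis .
  qed
  moreover have "t \<cdot> u2 \<cdot> y = t \<cdot> s1" using y t2 by (simp add: cmp_assoc)
  ultimately have "y \<in> S \<and> span_mor C y w w'"
    using y t1 t2 x unfolding span_mor_def w1 w2 by simp
  moreover have "tgt C (fst p) = tgt C (fst q)" "tgt C (snd p) = tgt C (snd q)"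
    using le by (auto simp: span_le_def)
  ultimately show ?thesis
    using span_comp_typing[OF w r sp(1)] span_comp_typing[OF w' r sp(2)]
    unfolding span_le_def by auto
qed

text \<open>The composites \<open>w\<close>, \<open>w'\<close> stay arbitrary in the induction
  because each link of a zig-zag may use its own pullbacks.\<close>

lemma span_comp_zigzag_right:
  assumes "(p, q) \<in> zigzag C S" "r \<in> spans C S" "is_span_comp C r p w" "is_span_comp C r q w'"
  shows "(w, w') \<in> zigzag C S"
  using assms
proof (induction arbitrary: w w')
  case (base p q)
  then show ?case by (blast intro: zigzag.base span_comp_mono_right)
next
  case (refl p)
  \<comment> \<open>Even for a single span \<open>p\<close> the composites \<open>w\<close> and
    \<open>w'\<close> may come from different pullbacks.\<close>
  then show ?case by (blast intro: zigzag.base span_comp_mono_right span_le_refl)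
next
  case (sym p q)
  then show ?case by (blast intro: zigzag.sym)
next
  case (trans p q v)
  \<comment> \<open>No composite with the intermediate span is given; one exists because zig-zag
    related spans share their ends.\<close>
  have "tgt C (snd q) = tgt C (fst r)"
    using span_comp_composable[OF trans.prems(2)] zigzag_spans(4)[OF trans.hyps(1)] by simp
  then obtain w'' where "is_span_comp C r q w''"
    using span_comp_ex zigzag_spans(2)[OF trans.hyps(1)] trans.prems(1) by blast
  then show ?case using trans by (blast intro: zigzag.trans)
qed

lemma span_comp_zigzag_left:
  assumes "(p, q) \<in> zigzag C S" "r \<in> spans C S" "is_span_comp C p r w" "is_span_comp C q r w'"
  shows "(w, w') \<in> zigzag C S"
  using assms
proof (induction arbitrary: w w')
  case (base p q)
  then show ?case by (blast intro: zigzag.base span_comp_mono_left)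
next
  case (refl p)
  then show ?case by (blast intro: zigzag.base span_comp_mono_left span_le_refl)
next
  case (sym p q)
  then show ?case by (blast intro: zigzag.sym)
next
  case (trans p q v)
  have "tgt C (snd r) = tgt C (fst q)"
    using span_comp_composable[OF trans.prems(2)] zigzag_spans(3)[OF trans.hyps(1)] by simp
  then obtain w'' where "is_span_comp C q r w''"
    using span_comp_ex zigzag_spans(2)[OF trans.hyps(1)] trans.prems(1) by blast
  then show ?case using trans by (blast intro: zigzag.trans)
qed

text \<open>One factor is exchanged at a time, passing through a composite \<open>v\<close> of
  \<open>p'\<close> with \<open>q\<close>.\<close>

lemma span_comp_zigzag:
  assumes p: "(p, p') \<in> zigzag C S" and q: "(q, q') \<in> zigzag C S"
    and w: "is_span_comp C q p w" and w': "is_span_comp C q' p' w'"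
  shows "(w, w') \<in> zigzag C S"
proof -
  note zp = zigzag_spans[OF p] and zq = zigzag_spans[OF q]
  have "tgt C (snd p') = tgt C (fst q)"
    using span_comp_composable[OF w] zp(4) by simp
  then obtain v where v: "is_span_comp C q p' v"
    using span_comp_ex zp zq by blast
  show ?thesis
    using span_comp_zigzag_right[OF p zq(1) w v] span_comp_zigzag_left[OF q zp(2) v w']
    by (rule zigzag.trans)
qed

section \<open>The quotient category of retractions\<close>

lemma Retr_simps [simp]:
  "objs (Retr C S) = objs C"
  "arrs (Retr C S) = spans C S // zigzag C S"
  "idt (Retr C S) a = cls (idt C a, idt C a)"
  by (simp_all add: Retr_def Span_quot_def)

lemma cls_arr [simp]: "p \<in> spans C S \<Longrightarrow> cls p \<in> spans C S // zigzag C S"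
  by (rule quotientI)

lemma Retr_arrE:
  assumes "X \<in> spans C S // zigzag C S"
  obtains s f where "X = cls (s, f)" "(s, f) \<in> spans C S"
  using assms by (auto elim!: quotientE)

lemma Retr_src [simp]:
  assumes "p \<in> spans C S" shows "src (Retr C S) (cls p) = tgt C (fst p)"
proof -
  have "(\<lambda>p. tgt C (fst p)) ` cls p = {tgt C (fst p)}"
    using assms by (auto dest: zigzag_spans(3) intro: zigzag.refl)
  then show ?thesis by (simp add: Retr_def Span_quot_def)
qed

lemma Retr_tgt [simp]:
  assumes "p \<in> spans C S" shows "tgt (Retr C S) (cls p) = tgt C (snd p)"
proof -
  have "(\<lambda>p. tgt C (snd p)) ` cls p = {tgt C (snd p)}"
    using assms by (auto dest: zigzag_spans(4) intro: zigzag.refl)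
  then show ?thesis by (simp add: Retr_def Span_quot_def)
qed

text \<open>The composition of \<open>Span_quot\<close> gathers the composites of all
  representatives. By compatibility they all lie in the class of \<open>w\<close>, so any one
  composite computes the product.\<close>

lemma Retr_cmp:
  assumes p: "p \<in> spans C S" and q: "q \<in> spans C S" and w: "is_span_comp C q p w"
  shows "cls q \<cdot>\<^bsub>Retr C S\<^esub> cls p = cls w"
proof -
  define W where "W = {w. \<exists>q'\<in>cls q. \<exists>p'\<in>cls p. is_span_comp C q' p' w}"
  have "w \<in> W" using assms unfolding W_def by (blast intro: zigzag.refl)
  moreover have "(w, w') \<in> zigzag C S" if "w' \<in> W" for w'
    using that span_comp_zigzag[OF _ _ w] unfolding W_def by blast
  ultimately have "zigzag C S `` W = cls w"
    by (blast intro: zigzag.trans)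
  then show ?thesis by (simp add: Retr_def Span_quot_def W_def)
qed

lemma Retr_cmp_pullback:
  assumes "(s, f) \<in> spans C S" "(t, g) \<in> spans C S" "is_pullback C t f t' f'"
  shows "cls (t, g) \<cdot>\<^bsub>Retr C S\<^esub> cls (s, f) = cls (s \<cdot> t', g \<cdot> f')"
  using assms by (intro Retr_cmp) (auto simp: is_span_comp_def)

text \<open>Unit laws come from the trivial pullbacks of and along identities, associativity from
  pasting three squares to a common apex.\<close>

lemma Retr_category: "category (Retr C S)"
proof
  fix X assume "X \<in> arrs (Retr C S)"
  then obtain s f where X: "X = cls (s, f)" and sp: "(s, f) \<in> spans C S"
    by (auto elim: Retr_arrE)
  have pb: "is_pullback C (idt C (tgt C f)) f (idt C (src C f)) f"
    "is_pullback C s (idt C (tgt C s)) s (idt C (src C s))"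
    using pullback_idt[of f] pullback_sym[OF pullback_idt[of s]] sp by auto
  show "src (Retr C S) X \<in> objs (Retr C S)" "tgt (Retr C S) X \<in> objs (Retr C S)"
    using sp X by simp_all
  show "X \<cdot>\<^bsub>Retr C S\<^esub> idt (Retr C S) (src (Retr C S) X) = X"
    using sp X Retr_cmp_pullback[OF _ _ pb(2)] by (auto simp: idt_left idt_right)
  show "idt (Retr C S) (tgt (Retr C S) X) \<cdot>\<^bsub>Retr C S\<^esub> X = X"
    using sp X Retr_cmp_pullback[OF sp _ pb(1), of "idt C (tgt C f)"] idt_right[of s]
    by (simp add: idt_left)
next
  fix X Y assume "X \<in> arrs (Retr C S)" "Y \<in> arrs (Retr C S)" "tgt (Retr C S) X = src (Retr C S) Y"
  then obtain p q where X: "X = cls p" "p \<in> spans C S" and Y: "Y = cls q" "q \<in> spans C S"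
    and pq: "tgt C (snd p) = tgt C (fst q)"
    by (auto elim!: quotientE)
  obtain w where w: "is_span_comp C q p w" using span_comp_ex X Y pq by blast
  note sw = span_comp_typing[OF w X(2) Y(2)]
  have "Y \<cdot>\<^bsub>Retr C S\<^esub> X = cls w" unfolding X Y using Retr_cmp[OF _ _ w] X Y by simp
  then show "Y \<cdot>\<^bsub>Retr C S\<^esub> X \<in> arrs (Retr C S)"
    "src (Retr C S) (Y \<cdot>\<^bsub>Retr C S\<^esub> X) = src (Retr C S) X"
    "tgt (Retr C S) (Y \<cdot>\<^bsub>Retr C S\<^esub> X) = tgt (Retr C S) Y"
    using sw X Y by simp_all
next
  fix X Y Z
  assume "X \<in> arrs (Retr C S)" "Y \<in> arrs (Retr C S)" "Z \<in> arrs (Retr C S)"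
    "tgt (Retr C S) X = src (Retr C S) Y" "tgt (Retr C S) Y = src (Retr C S) Z"
  then obtain s1 f1 s2 f2 s3 f3 where
    XYZ: "X = cls (s1, f1)" "Y = cls (s2, f2)" "Z = cls (s3, f3)" and
    sp: "(s1, f1) \<in> spans C S" "(s2, f2) \<in> spans C S" "(s3, f3) \<in> spans C S" and
    ends: "tgt C f1 = tgt C s2" "tgt C f2 = tgt C s3"
    by (auto elim!: Retr_arrE)
  obtain s2' f1' where pb12: "is_pullback C s2 f1 s2' f1'"
    using pullback_ex[of s2 f1] sp ends by auto
  obtain s3' f2' where pb23: "is_pullback C s3 f2 s3' f2'"
    using pullback_ex[of s3 f2] sp ends by auto
  note t12 = pullback_typing(1-8)[OF pb12] and t23 = pullback_typing(1-8)[OF pb23]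
  have S': "s2' \<in> S" "s3' \<in> S" using pullback_S[OF _ pb12] pullback_S[OF _ pb23] sp by auto
  \<comment> \<open>This pullback over the apex of the middle span serves both bracketings:
    \<open>pbL\<close> pastes it onto \<open>pb23\<close>, \<open>pbR\<close> onto
    \<open>pb12\<close>. Both products then have equal representatives by
    \<open>cmp_assoc\<close>.\<close>
  obtain s3'' f1'' where pb: "is_pullback C s3' f1' s3'' f1''"
    using pullback_ex[of s3' f1'] sp S' t12 t23 by auto
  note t = pullback_typing(1-8)[OF pb]
  have pbL: "is_pullback C s3 (f2 \<cdot> f1') s3'' (f2' \<cdot> f1'')"
    by (rule pullback_pasting[OF pb23 pb])
  have pbR: "is_pullback C (s2 \<cdot> s3') f1 (s2' \<cdot> s3'') f1''"
    by (rule pullback_sym, rule pullback_pasting[OF pullback_sym[OF pb12] pullback_sym[OF pb]])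
  have YX: "Y \<cdot>\<^bsub>Retr C S\<^esub> X = cls (s1 \<cdot> s2', f2 \<cdot> f1')"
    unfolding XYZ using sp by (intro Retr_cmp_pullback pb12)
  have ZY: "Z \<cdot>\<^bsub>Retr C S\<^esub> Y = cls (s2 \<cdot> s3', f3 \<cdot> f2')"
    unfolding XYZ using sp by (intro Retr_cmp_pullback pb23)
  have "Z \<cdot>\<^bsub>Retr C S\<^esub> (Y \<cdot>\<^bsub>Retr C S\<^esub> X) = cls (s1 \<cdot> s2' \<cdot> s3'', f3 \<cdot> (f2' \<cdot> f1''))"
    unfolding YX unfolding XYZ
    by (intro Retr_cmp_pullback pbL) (use sp S' t12 t23 cmp_S in auto)
  moreover have "(Z \<cdot>\<^bsub>Retr C S\<^esub> Y) \<cdot>\<^bsub>Retr C S\<^esub> X = cls (s1 \<cdot> (s2' \<cdot> s3''), f3 \<cdot> f2' \<cdot> f1'')"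
    unfolding ZY unfolding XYZ
    by (intro Retr_cmp_pullback pbR) (use sp S' t12 t23 cmp_S in auto)
  moreover have "s1 \<cdot> s2' \<cdot> s3'' = s1 \<cdot> (s2' \<cdot> s3'')" "f3 \<cdot> f2' \<cdot> f1'' = f3 \<cdot> (f2' \<cdot> f1'')"
    using t t12 t23 sp by (auto simp: cmp_assoc)
  ultimately show "Z \<cdot>\<^bsub>Retr C S\<^esub> Y \<cdot>\<^bsub>Retr C S\<^esub> X = Z \<cdot>\<^bsub>Retr C S\<^esub> (Y \<cdot>\<^bsub>Retr C S\<^esub> X)"
    by simp
qed (simp_all)

section \<open>The canonical functors \<open>Phi_z\<close> and \<open>Psi_z\<close>\<close>

lemma op_wide_simps [simp]:
  "objs (op_cat (wide_subcat C S)) = objs C"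
  "arrs (op_cat (wide_subcat C S)) = S"
  "src (op_cat (wide_subcat C S)) = tgt C"
  "tgt (op_cat (wide_subcat C S)) = src C"
  "idt (op_cat (wide_subcat C S)) = idt C"
  "g \<cdot>\<^bsub>op_cat (wide_subcat C S)\<^esub> f = f \<cdot> g"
  by (simp_all add: op_cat_def wide_subcat_def)

lemma op_wide_category: "category (op_cat (wide_subcat C S))"
  by unfold_locales (simp_all add: cmp_S idt_left idt_right cmp_assoc)

lemma Phi_simps [simp]:
  "omap (Phi_z C S) a = a" "amap (Phi_z C S) f = cls (idt C (src C f), f)"
  by (simp_all add: Phi_z_def)

lemma Psi_simps [simp]:
  "omap (Psi_z C S) a = a" "amap (Psi_z C S) s = cls (s, idt C (src C s))"
  by (simp_all add: Psi_z_def)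

text \<open>The pullback of an identity along \<open>f\<close> is trivial, so composing two such
  spans multiplies only their second legs.\<close>

lemma Phi_functor: "cat_functor C (Retr C S) (Phi_z C S)"
proof (intro cat_functor.intro cat_functor_axioms.intro category_axioms Retr_category)
  fix f g assume fg: "f \<in> arrs C" "g \<in> arrs C" "tgt C f = src C g"
  have "is_pullback C (idt C (src C g)) f (idt C (src C f)) f"
    using pullback_idt[OF fg(1)] fg by simp
  from Retr_cmp_pullback[OF _ _ this]
  show "amap (Phi_z C S) (g \<cdot> f) = amap (Phi_z C S) g \<cdot>\<^bsub>Retr C S\<^esub> amap (Phi_z C S) f"
    using fg idt_left[of "idt C (src C f)"] by simp
qed simp_all

text \<open>The flipped trivial square is used. The first legs multiply to
  \<open>s \<cdot> t\<close> in \<open>C\<close>, which is the composite of \<open>t\<close> after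
  \<open>s\<close> in the opposite category.\<close>

lemma Psi_functor: "cat_functor (op_cat (wide_subcat C S)) (Retr C S) (Psi_z C S)"
proof (intro cat_functor.intro cat_functor_axioms.intro op_wide_category Retr_category)
  fix s t assume "s \<in> arrs (op_cat (wide_subcat C S))" "t \<in> arrs (op_cat (wide_subcat C S))"
    "tgt (op_cat (wide_subcat C S)) s = src (op_cat (wide_subcat C S)) t"
  then have st: "s \<in> S" "t \<in> S" "src C s = tgt C t" by simp_all
  have "is_pullback C t (idt C (src C s)) t (idt C (src C t))"
    using pullback_sym[OF pullback_idt[of t]] st by simp
  from Retr_cmp_pullback[OF _ _ this]
  show "amap (Psi_z C S) (t \<cdot>\<^bsub>op_cat (wide_subcat C S)\<^esub> s) =
      amap (Psi_z C S) t \<cdot>\<^bsub>Retr C S\<^esub> amap (Psi_z C S) s"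
    using st idt_left[of "idt C (src C t)"] by simp
qed simp_all

text \<open>The inner legs are both the identity of the apex, whose pullback is trivial. This
  equation determines every functor on \<open>Retr C S\<close> from its restrictions along
  \<open>Phi_z\<close> and \<open>Psi_z\<close>.\<close>

lemma span_factorization:
  assumes "(s, f) \<in> spans C S"
  shows "amap (Phi_z C S) f \<cdot>\<^bsub>Retr C S\<^esub> amap (Psi_z C S) s = cls (s, f)"
proof -
  have f: "f \<in> arrs C" "s \<in> arrs C" "src C s = src C f" using assms by auto
  have "is_pullback C (idt C (src C f)) (idt C (src C f)) (idt C (src C f)) (idt C (src C f))"
    using pullback_idt[of "idt C (src C f)"] f by simp
  from Retr_cmp_pullback[OF _ _ this] show ?thesis
    using assms f idt_right[of s] by (simp add: idt_right)
qed

text \<open>By \<open>span_factorization\<close> the product is the class of \<open>(s, s)\<close>,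
  and \<open>s\<close> itself, being in \<open>S\<close>, is a vertical morphism from that span to
  the identity span.\<close>

lemma Phi_Psi:
  assumes "s \<in> S"
  shows "amap (Phi_z C S) s \<cdot>\<^bsub>Retr C S\<^esub> amap (Psi_z C S) s = idt (Retr C S) (tgt C s)"
proof -
  let ?i = "idt C (tgt C s)"
  have "((s, s), (?i, ?i)) \<in> span_le C S"
    using assms by (auto simp: span_le_def span_mor_def idt_left intro!: bexI[of _ s])
  then show ?thesis
    using assms cls_eq_iff[of "(s, s)" "(?i, ?i)"] span_factorization[of s s] zigzag.base by fastforce
qed

end

section \<open>The universal property: extending a pair of functors\<close>

locale retraction_pair = stable_class C S + F: cat_functor C D F +
  G: cat_functor "op_cat (wide_subcat C S)" D G
  for C :: "('o, 'm) cat" (structure) and S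
    and D :: "('p, 'n) cat" and F :: "('o, 'm, 'p, 'n) fctr" and G :: "('o, 'm, 'p, 'n) fctr" +
  assumes BC: "beck_chevalley C S D F G"
    and retraction: "s \<in> S \<Longrightarrow> amap F s \<cdot>\<^bsub>D\<^esub> amap G s = idt D (omap F (tgt C s))"
begin

definition ext_fun :: "'m \<times> 'm \<Rightarrow> 'n"
  where "ext_fun p = amap F (snd p) \<cdot>\<^bsub>D\<^esub> amap G (fst p)"

text \<open>No representative is chosen: by \<open>ext_fun_zigzag\<close> the image of a class under
  \<open>ext_fun\<close> is a singleton.\<close>

definition ext :: "('o, ('m \<times> 'm) set, 'p, 'n) fctr"
  where "ext = \<lparr>omap = omap F, amap = (\<lambda>X. the_elem (ext_fun ` X))\<rparr>"

lemma omap_G: "a \<in> objs C \<Longrightarrow> omap G a = omap F a"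
  using BC by (simp add: beck_chevalley_def)

lemma F_typing:
  assumes "f \<in> arrs C"
  shows "amap F f \<in> arrs D" "src D (amap F f) = omap F (src C f)" "tgt D (amap F f) = omap F (tgt C f)"
  using assms F.amap_arr F.amap_src F.amap_tgt by auto

text \<open>Contravariance swaps the ends, and agreement of \<open>F\<close> and \<open>G\<close> on
  objects allows \<open>omap F\<close> throughout.\<close>

lemma G_typing:
  assumes "s \<in> S"
  shows "amap G s \<in> arrs D" "src D (amap G s) = omap F (tgt C s)" "tgt D (amap G s) = omap F (src C s)"
  using assms G.amap_arr[of s] G.amap_src[of s] G.amap_tgt[of s] omap_G by auto

lemma G_cmp:
  "\<lbrakk>s \<in> S; t \<in> S; tgt C t = src C s\<rbrakk> \<Longrightarrow> amap G (s \<cdot> t) = amap G t \<cdot>\<^bsub>D\<^esub> amap G s"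
  using G.amap_cmp[of s t] by simp

text \<open>With \<open>s = u \<cdot> x\<close> and \<open>f = h \<cdot> x\<close> the value expands
  to \<open>F h \<cdot> F x \<cdot> G x \<cdot> G u\<close>, where the middle pair cancels by
  \<open>retraction\<close>.\<close>

lemma ext_fun_span_le:
  assumes "(p, q) \<in> span_le C S"
  shows "ext_fun p = ext_fun q"
proof -
  obtain s f u h where eqs: "p = (s, f)" "q = (u, h)" by (cases p; cases q)
  obtain x where x: "x \<in> S" "tgt C x = src C u" "u \<cdot> x = s" "h \<cdot> x = f"
    and uh: "u \<in> S" "h \<in> arrs C" "src C u = src C h"
    using assms
    unfolding span_le_def span_mor_def eqs mem_Collect_eq case_prod_conv fst_conv snd_conv spans_iff
    by blast
  note t = F_typing[OF uh(2)] F_typing[OF S_arr[OF x(1)]] G_typing[OF uh(1)] G_typing[OF x(1)]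
  have "ext_fun p = (amap F h \<cdot>\<^bsub>D\<^esub> amap F x) \<cdot>\<^bsub>D\<^esub> (amap G x \<cdot>\<^bsub>D\<^esub> amap G u)"
    unfolding ext_fun_def eqs using x uh G_cmp[of u x] F.amap_cmp[of x h] by auto
  also have "\<dots> = amap F h \<cdot>\<^bsub>D\<^esub> (amap F x \<cdot>\<^bsub>D\<^esub> (amap G x \<cdot>\<^bsub>D\<^esub> amap G u))"
    by (rule F.B.cmp_assoc) (use t x uh in auto)
  also have "amap F x \<cdot>\<^bsub>D\<^esub> (amap G x \<cdot>\<^bsub>D\<^esub> amap G u) = amap F x \<cdot>\<^bsub>D\<^esub> amap G x \<cdot>\<^bsub>D\<^esub> amap G u"
    by (rule F.B.cmp_assoc[symmetric]) (use t x uh in auto)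
  also have "\<dots> = amap G u"
    using retraction[OF x(1)] F.B.idt_left[OF t(7)] x t by simp
  finally show ?thesis by (simp add: ext_fun_def eqs)
qed

lemma ext_fun_zigzag: "(p, q) \<in> zigzag C S \<Longrightarrow> ext_fun p = ext_fun q"
  by (induction rule: zigzag.induct) (auto dest: ext_fun_span_le)

lemma amap_ext [simp]:
  assumes "p \<in> spans C S" shows "amap ext (cls p) = ext_fun p"
proof -
  have "ext_fun ` cls p = {ext_fun p}"
    using assms ext_fun_zigzag by (auto intro: zigzag.refl)
  then show ?thesis by (simp add: ext_def)
qed

lemma omap_ext [simp]: "omap ext = omap F"
  by (simp add: ext_def)

lemma ext_fun_typing:
  assumes "p \<in> spans C S"
  shows "ext_fun p \<in> arrs D" "src D (ext_fun p) = omap F (tgt C (fst p))"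
    "tgt D (ext_fun p) = omap F (tgt C (snd p))"
  using assms F_typing[of "snd p"] G_typing[of "fst p"]
  by (cases p; simp add: ext_fun_def)+

text \<open>The inner factors of the expanded composite are \<open>F f' \<cdot> G t'\<close>.
  Beck-Chevalley turns them into \<open>G t \<cdot> F f\<close>; the rest is reassociation.\<close>

lemma ext_fun_comp:
  assumes sp: "(s, f) \<in> spans C S" "(t, g) \<in> spans C S" and pb: "is_pullback C t f t' f'"
  shows "ext_fun (s \<cdot> t', g \<cdot> f') = ext_fun (t, g) \<cdot>\<^bsub>D\<^esub> ext_fun (s, f)"
proof -
  have c: "s \<in> S" "t \<in> S" "t' \<in> S" "g \<in> arrs C" "f \<in> arrs C" "f' \<in> arrs C"
    "src C s = src C f" "src C t = src C g"
    using sp pullback_S[OF _ pb] pullback_typing[OF pb] by auto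
  note [simp] = F_typing[OF c(4)] F_typing[OF c(5)] F_typing[OF c(6)]
    G_typing[OF c(1)] G_typing[OF c(2)] G_typing[OF c(3)] pullback_typing(5-8)[OF pb] c
  have bc: "amap F f' \<cdot>\<^bsub>D\<^esub> amap G t' = amap G t \<cdot>\<^bsub>D\<^esub> amap F f"
    using BC pb c unfolding beck_chevalley_def by metis
  have "ext_fun (s \<cdot> t', g \<cdot> f') = (amap F g \<cdot>\<^bsub>D\<^esub> amap F f') \<cdot>\<^bsub>D\<^esub> (amap G t' \<cdot>\<^bsub>D\<^esub> amap G s)"
    unfolding ext_fun_def using G_cmp[of s t'] F.amap_cmp[of f' g] by simp
  also have "\<dots> = amap F g \<cdot>\<^bsub>D\<^esub> ((amap F f' \<cdot>\<^bsub>D\<^esub> amap G t') \<cdot>\<^bsub>D\<^esub> amap G s)"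
    by (simp add: F.B.cmp_assoc)
  also have "\<dots> = ext_fun (t, g) \<cdot>\<^bsub>D\<^esub> ext_fun (s, f)"
    unfolding bc ext_fun_def by (simp add: F.B.cmp_assoc)
  finally show ?thesis .
qed

lemma ext_functor: "cat_functor (Retr C S) D ext"
proof (intro cat_functor.intro cat_functor_axioms.intro Retr_category F.B.category_axioms)
  fix a assume "a \<in> objs (Retr C S)"
  \<comment> \<open>Identities lie in \<open>S\<close>, so preservation of identities is an instance
    of \<open>retraction\<close>.\<close>
  then show "omap ext a \<in> objs D" "amap ext (idt (Retr C S) a) = idt D (omap ext a)"
    using F.omap_obj retraction[of "idt C a"] by (simp_all add: ext_fun_def)
next
  fix X assume "X \<in> arrs (Retr C S)"
  then show "amap ext X \<in> arrs D" "src D (amap ext X) = omap ext (src (Retr C S) X)"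
    "tgt D (amap ext X) = omap ext (tgt (Retr C S) X)"
    by (auto elim!: quotientE simp: ext_fun_typing)
next
  fix X Y assume "X \<in> arrs (Retr C S)" "Y \<in> arrs (Retr C S)" "tgt (Retr C S) X = src (Retr C S) Y"
  then obtain s f t g where X: "X = cls (s, f)" "(s, f) \<in> spans C S"
    and Y: "Y = cls (t, g)" "(t, g) \<in> spans C S" and e: "tgt C f = tgt C t"
    by (auto elim!: Retr_arrE)
  obtain t' f' where pb: "is_pullback C t f t' f'"
    using pullback_ex[of t f] X Y e by auto
  have "(s \<cdot> t', g \<cdot> f') \<in> spans C S"
    using span_comp_typing(1)[of "(t, g)" "(s, f)" "(s \<cdot> t', g \<cdot> f')"] pb X(2) Y(2)
    by (auto simp: is_span_comp_def)
  then show "amap ext (Y \<cdot>\<^bsub>Retr C S\<^esub> X) = amap ext Y \<cdot>\<^bsub>D\<^esub> amap ext X"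
    unfolding X(1) Y(1) Retr_cmp_pullback[OF X(2) Y(2) pb]
    using X(2) Y(2) by (simp only: amap_ext ext_fun_comp[OF X(2) Y(2) pb])
qed

text \<open>On spans from \<open>Phi_z\<close> the factor \<open>G\<close> is applied to an identity
  and drops out; in \<open>ext_Psi\<close> the same happens to \<open>F\<close>.\<close>

lemma ext_Phi: "fctr_eq C (fctr_comp ext (Phi_z C S)) F"
proof -
  have "amap F f \<cdot>\<^bsub>D\<^esub> amap G (idt C (src C f)) = amap F f" if "f \<in> arrs C" for f
    using that G.amap_idt[of "src C f"] F.B.idt_right[of "amap F f"] F_typing[OF that] omap_G by simp
  then show ?thesis by (auto simp: fctr_eq_def fctr_comp_def ext_fun_def)
qed

lemma ext_Psi: "fctr_eq (op_cat (wide_subcat C S)) (fctr_comp ext (Psi_z C S)) G"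
proof -
  have "amap F (idt C (src C s)) \<cdot>\<^bsub>D\<^esub> amap G s = amap G s" if "s \<in> S" for s
    using that F.amap_idt[of "src C s"] F.B.idt_left[of "amap G s"] G_typing[OF that] by simp
  then show ?thesis by (auto simp: fctr_eq_def fctr_comp_def ext_fun_def omap_G)
qed

text \<open>A functor \<open>H\<close> preserves the factorization of each span, and its values on
  both factors are prescribed by \<open>F\<close> and \<open>G\<close>.\<close>

lemma ext_unique:
  assumes H: "cat_functor (Retr C S) D H"
    and F': "fctr_eq C (fctr_comp H (Phi_z C S)) F"
    and G': "fctr_eq (op_cat (wide_subcat C S)) (fctr_comp H (Psi_z C S)) G"
  shows "fctr_eq (Retr C S) H ext"
proof -
  interpret H: cat_functor "Retr C S" D H by (rule H)
  have "amap H (cls (s, f)) = ext_fun (s, f)" if sp: "(s, f) \<in> spans C S" for s f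
  proof -
    have "amap H (cls (s, f)) = amap H (amap (Phi_z C S) f) \<cdot>\<^bsub>D\<^esub> amap H (amap (Psi_z C S) s)"
      using span_factorization[OF sp] H.amap_cmp[of "amap (Psi_z C S) s" "amap (Phi_z C S) f"] sp
      by auto
    also have "\<dots> = ext_fun (s, f)"
      using F' G' sp by (auto simp: fctr_eq_def fctr_comp_def ext_fun_def)
    finally show ?thesis .
  qed
  \<comment> \<open>As \<open>Phi_z\<close> is the identity on objects, \<open>F'\<close> settles
    the object part.\<close>
  then show ?thesis
    using F' by (auto simp: fctr_eq_def fctr_comp_def elim!: Retr_arrE)
qed

end

theorem proposition2:
  fixes C :: "('o, 'm) cat" and S :: "'m set"
  assumes "stable_class C S"
  shows
    "cat_functor C (Retr C S) (Phi_z C S) \<and>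
     cat_functor (op_cat (wide_subcat C S)) (Retr C S) (Psi_z C S) \<and>
     (\<forall>s\<in>S. amap (Phi_z C S) s \<cdot>\<^bsub>Retr C S\<^esub> amap (Psi_z C S) s = idt (Retr C S) (tgt C s)) \<and>
     (\<forall>(D :: ('p, 'n) cat) F G.
        cat_functor C D F \<and>
        cat_functor (op_cat (wide_subcat C S)) D G \<and>
        beck_chevalley C S D F G \<and>
        (\<forall>s\<in>S. amap F s \<cdot>\<^bsub>D\<^esub> amap G s = idt D (omap F (tgt C s))) \<longrightarrow>
        (\<exists>H. (cat_functor (Retr C S) D H \<and>
              fctr_eq C (fctr_comp H (Phi_z C S)) F \<and>
              fctr_eq (op_cat (wide_subcat C S)) (fctr_comp H (Psi_z C S)) G) \<and>
             (\<forall>H'. cat_functor (Retr C S) D H' \<and>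
              fctr_eq C (fctr_comp H' (Phi_z C S)) F \<and>
              fctr_eq (op_cat (wide_subcat C S)) (fctr_comp H' (Psi_z C S)) G \<longrightarrow>
              fctr_eq (Retr C S) H' H)))"
proof -
  interpret stable_class C S by (rule assms)
  have "\<exists>H. (cat_functor (Retr C S) D H \<and>
              fctr_eq C (fctr_comp H (Phi_z C S)) F \<and>
              fctr_eq (op_cat (wide_subcat C S)) (fctr_comp H (Psi_z C S)) G) \<and>
             (\<forall>H'. cat_functor (Retr C S) D H' \<and>
              fctr_eq C (fctr_comp H' (Phi_z C S)) F \<and>
              fctr_eq (op_cat (wide_subcat C S)) (fctr_comp H' (Psi_z C S)) G \<longrightarrow>
              fctr_eq (Retr C S) H' H)"
    if "cat_functor C D F" "cat_functor (op_cat (wide_subcat C S)) D G" "beck_chevalley C S D F G"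
      "\<forall>s\<in>S. amap F s \<cdot>\<^bsub>D\<^esub> amap G s = idt D (omap F (tgt C s))"
    for D :: "('p, 'n) cat" and F G
  proof -
    interpret retraction_pair C S D F G
      using that assms by (simp add: retraction_pair_def retraction_pair_axioms_def)
    show ?thesis using ext_functor ext_Phi ext_Psi ext_unique by blast
  qed
  then show ?thesis using Phi_functor Psi_functor Phi_Psi by blast
qed

end
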